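(* Let $\mathcal{A}\in\mathbb{R}^{[m,n]}$ be a nonsingular $M$-tensor and $b\in\mathbb{R}^n$, and suppose that $\mathcal{S}_l=\{x\in\mathbb{R}^n\mid x\ge 0,\ \mathcal{A}x^{m-1}\le b\}\ne\emptyset$. Let $\mathcal{A}=\mathcal{M}-\mathcal{N}$ be the level-1 splitting and $M$ the majorization matrix of $\mathcal{A}$. Let $M=P-Q$ and $M=\hat{P}-\hat{Q}$ be two splittings, where $P,\hat{P}$ are nonsingular $M$-matrices and $Q,\hat{Q}\ge 0$. Let $\{x_k\}$ and $\{\hat{x}_k\}$ be the sequences of nonnegative vectors given, for $k\ge0$, by $$P x_{k+1}^{[m-1]}=Q x_k^{[m-1]}+\mathcal{N}x_k^{m-1}+b,\qquad \hat{P}\hat{x}_{k+1}^{[m-1]}=\hat{Q}\hat{x}_k^{[m-1]}+\mathcal{N}\hat{x}_k^{m-1}+b,$$ with $x_0\ge\hat{x}_0>0$ satisfying $$\mathcal{A}x_0^{m-1}>0,\quad \mathcal{A}x_0^{m-1}\ge b,\quad \mathcal{A}\hat{x}_0^{m-1}>0,\quad \mathcal{A}\hat{x}_0^{m-1}\ge b.$$ If $\hat{Q}\le Q$, then $x_k\ge\hat{x}_k$ for all $k\ge 0$.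
   Context: $\mathbb{R}^{[m,n]}$ ($m\ge 2$, $n\ge 1$) is the set of real $m$th-order $n$-dimensional tensors $\mathcal{A}=(a_{i_1i_2\ldots i_m})$, $1\le i_1,\ldots,i_m\le n$. For $x\in\mathbb{R}^n$, $\mathcal{A}x^{m-1}\in\mathbb{R}^n$ has entries $(\mathcal{A}x^{m-1})_i=\sum_{i_2,\ldots,i_m=1}^n a_{ii_2\ldots i_m}x_{i_2}\cdots x_{i_m}$. Inequalities for vectors, matrices and tensors are entrywise. For $r>0$, $x^{[r]}$ is the entrywise power, $(x^{[r]})_i=(x_i)^r$. The identity tensor $\mathcal{I}$ has diagonal elements $\mathcal{I}_{ii\ldots i}=1$ and all other elements $0$. A real $\lambda$ is an eigenvalue of $\mathcal{B}$ if $\mathcal{B}x^{m-1}=\lambda x^{[m-1]}$ for some $x\in\mathbb{R}^n\setminus\{0\}$; the spectral radius $\rho(\mathcal{B})$ is the maximum modulus of the eigenvalues. $\mathcal{A}$ is a nonsingular $M$-tensor if $\mathcal{A}=s\mathcal{I}-\mathcal{B}$ with $\mathcal{B}\ge 0$ and $s>\rho(\mathcal{B})$. Level-1 splitting: $\mathcal{A}=\mathcal{M}-\mathcal{N}$, where $\mathcal{M}=(m_{i_1\ldots i_m})$ has $m_{ij\ldots j}=a_{ij\ldots j}$ for all $i,j\in\{1,\ldots,n\}$ and all other elements zero. The majorization matrix of $\mathcal{A}$ is the $n\times n$ matrix $M$ with $(i,j)$ entry $a_{ij\ldots j}$, so $\mathcal{M}x^{m-1}=Mx^{[m-1]}$.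 A nonsingular $M$-matrix is a matrix of the form $sI-B$ with $B\ge 0$ and $s>\rho(B)$. Explicitly, the iteration is $x_{k+1}=\left(P^{-1}(Qx_k^{[m-1]}+\mathcal{N}x_k^{m-1}+b)\right)^{[1/(m-1)]}$, the vector raised to the power $1/(m-1)$ being nonnegative for each $k$ under the hypotheses. *)

theory Defs
  imports "HOL-Analysis.Analysis"
begin

text \<open>
  An order-\<open>m\<close> tensor of dimension \<open>CARD('n)\<close> is a function on index lists. Only its values on lists
  of length \<open>m\<close> are entries of the tensor; values on other lists are irrelevant, so the order is a
  parameter of the notions below and every condition is restricted to lists of length \<open>m\<close>.
\<close>

type_synonym 'n tensor = "'n list \<Rightarrow> real"

definition tensor_nonneg :: "nat \<Rightarrow> 'n tensor \<Rightarrow> bool" where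
  "tensor_nonneg m \<B> \<longleftrightarrow> (\<forall>is. length is = m \<longrightarrow> 0 \<le> \<B> is)"

definition identity_tensor :: "nat \<Rightarrow> 'n tensor" where
  "identity_tensor m is = (if \<exists>i. is = replicate m i then 1 else 0)"

text \<open>The vector \<open>\<A> x\<^sup>m\<^sup>-\<^sup>1\<close>; the list \<open>js\<close> is \<open>(i\<^sub>2, \<dots>, i\<^sub>m)\<close>.\<close>

definition tensor_app :: "nat \<Rightarrow> 'n::finite tensor \<Rightarrow> real ^ 'n \<Rightarrow> real ^ 'n" where
  "tensor_app m \<A> x = (\<chi> i. \<Sum>js | length js = m - 1. \<A> (i # js) * (\<Prod>j\<leftarrow>js. x $ j))"

definition vec_power :: "real ^ 'n \<Rightarrow> nat \<Rightarrow> real ^ 'n" where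
  "vec_power x r = (\<chi> i. (x $ i) ^ r)"

definition tensor_eigenvalue :: "nat \<Rightarrow> 'n::finite tensor \<Rightarrow> real \<Rightarrow> bool" where
  "tensor_eigenvalue m \<B> \<mu> \<longleftrightarrow>
     (\<exists>x. x \<noteq> 0 \<and> tensor_app m \<B> x = \<mu> *\<^sub>R vec_power x (m - 1))"

text \<open>
  The maximum modulus of the eigenvalues, written as a supremum: for \<open>m \<ge> 2\<close> the set of eigenvalues
  is compact, so the supremum is attained whenever an eigenvalue exists. For a nonnegative tensor,
  the only case used below, one exists by the Perron-Frobenius theorem.
\<close>

definition tensor_spectral_radius :: "nat \<Rightarrow> 'n::finite tensor \<Rightarrow> real" where
  "tensor_spectral_radius m \<B> = Sup {\<bar>\<mu>\<bar> | \<mu>. tensor_eigenvalue m \<B> \<mu>}"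

definition nonsingular_M_tensor :: "nat \<Rightarrow> 'n::finite tensor \<Rightarrow> bool" where
  "nonsingular_M_tensor m \<A> \<longleftrightarrow>
     (\<exists>s \<B>. (\<forall>is. length is = m \<longrightarrow> \<A> is = s * identity_tensor m is - \<B> is) \<and>
            tensor_nonneg m \<B> \<and> tensor_spectral_radius m \<B> < s)"

text \<open>
  For matrices the spectral radius is the usual one, over the complex eigenvalues. They form a
  finite nonempty set, so the supremum is the maximum.
\<close>

definition matrix_eigenvalue :: "real ^ 'n ^ 'n \<Rightarrow> complex \<Rightarrow> bool" where
  "matrix_eigenvalue B \<mu> \<longleftrightarrow>
     (\<exists>v :: complex ^ 'n. v \<noteq> 0 \<and> map_matrix complex_of_real B *v v = \<mu> *s v)"

definition matrix_spectral_radius :: "real ^ 'n ^ 'n \<Rightarrow> real" where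
  "matrix_spectral_radius B = Sup {cmod \<mu> | \<mu>. matrix_eigenvalue B \<mu>}"

definition nonsingular_M_matrix :: "real ^ 'n ^ 'n \<Rightarrow> bool" where
  "nonsingular_M_matrix P \<longleftrightarrow> (\<exists>s B. P = mat s - B \<and> 0 \<le> B \<and> matrix_spectral_radius B < s)"

definition level1_splitting :: "nat \<Rightarrow> 'n tensor \<Rightarrow> 'n tensor \<Rightarrow> 'n tensor \<Rightarrow> bool" where
  "level1_splitting m \<A> \<M> \<N> \<longleftrightarrow>
     (\<forall>is. length is = m \<longrightarrow>
        \<M> is = (if \<exists>i j. is = i # replicate (m - 1) j then \<A> is else 0) \<and>
        \<A> is = \<M> is - \<N> is)"

definition majorization_matrix :: "nat \<Rightarrow> 'n tensor \<Rightarrow> real ^ 'n ^ 'n" where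
  "majorization_matrix m \<A> = (\<chi> i j. \<A> (i # replicate (m - 1) j))"

definition S_l :: "nat \<Rightarrow> 'n::finite tensor \<Rightarrow> real ^ 'n \<Rightarrow> (real ^ 'n) set" where
  "S_l m \<A> b = {x. 0 \<le> x \<and> tensor_app m \<A> x \<le> b}"

end

theory Submission
  imports Defs
begin

text \<open>
  In the variable \<open>y = x\<^sup>[\<^sup>m\<^sup>-\<^sup>1\<^sup>]\<close> one step of the iteration from \<open>x\<^sub>k\<close> reads
  \<open>P (y\<^sub>k - y\<^sub>k\<^sub>+\<^sub>1) = \<A> x\<^sub>k\<^sup>m\<^sup>-\<^sup>1 - b\<close>. Since \<open>P\<close> is inverse nonnegative and \<open>\<N>\<close> and \<open>Q\<close> are nonnegative,
  \<open>\<A> x\<^sub>k\<^sup>m\<^sup>-\<^sup>1 \<ge> b\<close> propagates and forces \<open>x\<^sub>k\<^sub>+\<^sub>1 \<le> x\<^sub>k\<close>. As \<open>P - P' = Q - Q' \<ge> 0\<close>, the decrease of the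
  second sequence gives \<open>P y'\<^sub>k\<^sub>+\<^sub>1 \<le> Q y'\<^sub>k + \<N> x'\<^sub>k\<^sup>m\<^sup>-\<^sup>1 + b\<close>, and the comparison follows by induction.

  Inverse nonnegativity of \<open>P = s I - B\<close>: if \<open>P z \<ge> 0\<close>, then the negative part \<open>w\<close> of \<open>z\<close> satisfies
  \<open>B w \<ge> s w\<close>. If \<open>w \<noteq> 0\<close>, Brouwer's theorem gives an eigenvalue of \<open>B\<close> that is at least \<open>s\<close>.
\<close>

section \<open>Nonnegative matrices: from a subinvariant vector to an eigenvector\<close>

lemma matrix_vector_mult_mono:
  fixes B :: "real ^ 'n ^ 'm" and u v :: "real ^ 'n"
  assumes "0 \<le> B" "u \<le> v"
  shows "B *v u \<le> B *v v"
  using assms by (auto simp: less_eq_vec_def matrix_vector_mult_def intro!: sum_mono mult_left_mono)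

lemma mat_vector_mult_eq_scaleR:
  fixes z :: "real ^ 'n"
  shows "mat s *v z = s *\<^sub>R z"
  by (simp add: vec_eq_iff matrix_vector_mult_def mat_def mult_delta_left)

text \<open>All three conditions are affine in \<open>u\<close>. This slice of the simplex is the
  domain of the Brouwer argument below.\<close>

lemma convex_subinvariant_vectors:
  fixes B :: "real ^ 'n ^ 'n"
  shows "convex {u. 0 \<le> u \<and> (\<Sum>i\<in>UNIV. u $ i) = 1 \<and> t *\<^sub>R u \<le> B *v u}"
  unfolding convex_def
proof (clarify, intro conjI)
  fix x y :: "real ^ 'n" and u v :: real
  assume uv: "0 \<le> u" "0 \<le> v" "u + v = 1"
    and x: "0 \<le> x" "(\<Sum>i\<in>UNIV. x $ i) = 1" "t *\<^sub>R x \<le> B *v x"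
    and y: "0 \<le> y" "(\<Sum>i\<in>UNIV. y $ i) = 1" "t *\<^sub>R y \<le> B *v y"
  show "0 \<le> u *\<^sub>R x + v *\<^sub>R y" using uv x y by (auto simp: less_eq_vec_def)
  show "(\<Sum>i\<in>UNIV. (u *\<^sub>R x + v *\<^sub>R y) $ i) = 1"
    using uv x y by (simp add: sum.distrib flip: sum_distrib_left)
  have "u *\<^sub>R (t *\<^sub>R x) + v *\<^sub>R (t *\<^sub>R y) \<le> u *\<^sub>R (B *v x) + v *\<^sub>R (B *v y)"
    using uv x(3) y(3) by (intro add_mono scaleR_left_mono)
  then show "t *\<^sub>R (u *\<^sub>R x + v *\<^sub>R y) \<le> B *v (u *\<^sub>R x + v *\<^sub>R y)"
    by (simp add: matrix_vector_right_distrib scaleR_right_distrib matrix_vector_mult_scaleR mult.commute[of t])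
qed

lemma compact_subinvariant_vectors:
  fixes B :: "real ^ 'n ^ 'n"
  shows "compact {u. 0 \<le> u \<and> (\<Sum>i\<in>UNIV. u $ i) = 1 \<and> t *\<^sub>R u \<le> B *v u}" (is "compact ?K")
proof -
  have "?K = {u. \<forall>i. 0 \<le> u $ i} \<inter> {u. (\<Sum>i\<in>UNIV. u $ i) = 1}
              \<inter> {u. \<forall>i. t * u $ i \<le> (\<Sum>j\<in>UNIV. B $ i $ j * u $ j)}"
    by (auto simp: less_eq_vec_def matrix_vector_mult_def)
  moreover have "closed \<dots>"
    by (intro closed_Int closed_Collect_all closed_Collect_le closed_Collect_eq continuous_intros)
  ultimately have "closed ?K" by simp
  moreover have "bounded ?K"
  proof (rule boundedI)
    fix u assume "u \<in> ?K"
    then have "(\<Sum>i\<in>UNIV. \<bar>u $ i\<bar>) = 1" by (auto simp: less_eq_vec_def)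
    then show "norm u \<le> 1" using norm_le_l1_cart[of u] by simp
  qed
  ultimately show ?thesis by (simp add: compact_eq_bounded_closed)
qed

text \<open>
  Brouwer is applied to \<open>u \<mapsto> (u + B u) / \<parallel>u + B u\<parallel>\<^sub>1\<close> on a set it preserves because \<open>B \<ge> 0\<close>;
  adding \<open>u\<close> keeps the denominator positive when \<open>t \<le> 0\<close>.
\<close>

lemma nonneg_matrix_eigenvector_ge:
  fixes B :: "real ^ 'n ^ 'n" and w :: "real ^ 'n"
  assumes B: "0 \<le> B" and w: "0 \<le> w" "w \<noteq> 0" and sub: "t *\<^sub>R w \<le> B *v w"
  obtains r u where "t \<le> r" "u \<noteq> 0" "B *v u = r *\<^sub>R u"
proof -
  define \<sigma> :: "real ^ 'n \<Rightarrow> real" where "\<sigma> u = (\<Sum>i\<in>UNIV. u $ i)" for u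
  define K where "K = {u. 0 \<le> u \<and> \<sigma> u = 1 \<and> t *\<^sub>R u \<le> B *v u}"
  define g where "g u = u + B *v u" for u
  define f where "f u = inverse (\<sigma> (g u)) *\<^sub>R g u" for u
  have \<sigma>_scale: "\<sigma> (c *\<^sub>R u) = c * \<sigma> u" for c u by (simp add: \<sigma>_def sum_distrib_left)
  \<comment> \<open>Nonnegativity and subinvariance survive positive scaling, so only the coordinate
    sum has to be normalized to land in \<open>K\<close>.\<close>
  have normalize: "inverse (\<sigma> u) *\<^sub>R u \<in> K" if "0 \<le> u" "0 < \<sigma> u" "t *\<^sub>R u \<le> B *v u" for u
  proof -
    have "inverse (\<sigma> u) *\<^sub>R (t *\<^sub>R u) \<le> inverse (\<sigma> u) *\<^sub>R (B *v u)"
      using that by (auto simp: less_eq_vec_def intro!: mult_left_mono)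
    then show ?thesis
      using that by (auto simp: K_def \<sigma>_scale matrix_vector_mult_scaleR less_eq_vec_def mult.left_commute)
  qed
  have g: "0 \<le> g u \<and> 1 \<le> \<sigma> (g u) \<and> t *\<^sub>R g u \<le> B *v g u" if "u \<in> K" for u
  proof -
    have u: "0 \<le> u" "\<sigma> u = 1" "t *\<^sub>R u \<le> B *v u" using that by (auto simp: K_def)
    have Bu: "0 \<le> B *v u" using matrix_vector_mult_mono[OF B u(1)] by simp
    \<comment> \<open>Applying \<open>B\<close> to the inequality for \<open>u\<close> shows that
      \<open>B *v u\<close> is subinvariant too, hence so is the sum \<open>g u\<close>.\<close>
    have "t *\<^sub>R (B *v u) \<le> B *v (B *v u)"
      using matrix_vector_mult_mono[OF B u(3)] by (simp add: matrix_vector_mult_scaleR)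
    with u(3) have "t *\<^sub>R g u \<le> B *v g u"
      by (auto simp: g_def matrix_vector_right_distrib scaleR_right_distrib less_eq_vec_def intro!: add_mono)
    moreover have "1 \<le> \<sigma> (g u)"
      using u Bu by (auto simp: g_def \<sigma>_def sum.distrib less_eq_vec_def intro!: sum_nonneg)
    moreover have "0 \<le> g u" using u Bu by (auto simp: g_def less_eq_vec_def)
    ultimately show ?thesis by simp
  qed
  have "0 < \<sigma> w"
  proof -
    obtain i where "w $ i \<noteq> 0" using w by (auto simp: vec_eq_iff)
    with w show ?thesis unfolding \<sigma>_def
      by (intro sum_pos2[where i=i]) (auto simp: less_eq_vec_def order_less_le)
  qed
  then have "K \<noteq> {}" using normalize[OF w(1) _ sub] by auto
  moreover have "continuous_on K g"
    unfolding g_def by (intro continuous_on_add continuous_on_id linear_continuous_on matrix_vector_mul_bounded_linear)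
  then have "continuous_on K f"
    unfolding f_def \<sigma>_def using g by (intro continuous_intros) (force simp: \<sigma>_def)+
  moreover have "f ` K \<subseteq> K"
  proof clarify
    fix u assume "u \<in> K"
    then show "f u \<in> K" unfolding f_def using g[of u] by (intro normalize) auto
  qed
  moreover have "compact K" "convex K"
    unfolding K_def \<sigma>_def by (rule compact_subinvariant_vectors convex_subinvariant_vectors)+
  ultimately obtain u where u: "u \<in> K" "f u = u"
    using brouwer[of K f] by blast
  \<comment> \<open>At the fixed point, \<open>u + B *v u\<close> is \<open>\<sigma> (g u)\<close>
    times \<open>u\<close>; the shift by 1 removes the added \<open>u\<close>.\<close>
  define r where "r = \<sigma> (g u) - 1"
  have "\<sigma> (g u) *\<^sub>R f u = g u" using g[OF u(1)] by (simp add: f_def)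
  with u(2) have "u + B *v u = (r + 1) *\<^sub>R u" by (simp add: g_def r_def)
  then have "B *v u = r *\<^sub>R u" by (simp add: scaleR_left_distrib)
  moreover have "u \<noteq> 0" using u(1) by (auto simp: K_def \<sigma>_def)
  moreover have "t \<le> r"
  proof -
    \<comment> \<open>Summing coordinates turns subinvariance of the eigenvector into
      \<open>t \<le> r\<close>, because \<open>\<sigma> u = 1\<close>.\<close>
    have "\<sigma> (t *\<^sub>R u) \<le> \<sigma> (B *v u)"
      using u(1) unfolding K_def \<sigma>_def by (auto simp: less_eq_vec_def intro: sum_mono)
    then show ?thesis using u(1) by (simp add: K_def \<sigma>_scale \<open>B *v u = r *\<^sub>R u\<close>)
  qed
  ultimately show ?thesis using that by blast
qed

section \<open>Spectral radius and inverse nonnegativity of M-matrices\<close>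

lemma bdd_above_cmod_matrix_eigenvalues:
  fixes B :: "real ^ 'n ^ 'n"
  shows "bdd_above {cmod \<mu> | \<mu>. matrix_eigenvalue B \<mu>}"
proof (rule bdd_aboveI, clarify)
  fix \<mu> assume "matrix_eigenvalue B \<mu>"
  then obtain v :: "complex ^ 'n"
    where v: "v \<noteq> 0" "map_matrix complex_of_real B *v v = \<mu> *s v"
    by (auto simp: matrix_eigenvalue_def)
  \<comment> \<open>Estimating the eigenvector equation in the 1-norm bounds every eigenvalue by the
    sum of all \<open>\<bar>B $ i $ j\<bar>\<close>.\<close>
  define S where "S = (\<Sum>i\<in>UNIV. cmod (v $ i))"
  have le_S: "cmod (v $ j) \<le> S" for j unfolding S_def by (rule member_le_sum) auto
  obtain i where "v $ i \<noteq> 0" using v(1) by (auto simp: vec_eq_iff)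
  with le_S[of i] have "0 < S" using zero_less_norm_iff[of "v $ i"] by linarith
  have "cmod \<mu> * cmod (v $ i) \<le> (\<Sum>j\<in>UNIV. \<bar>B $ i $ j\<bar>) * S" for i
  proof -
    have "\<mu> * v $ i = (\<Sum>j\<in>UNIV. complex_of_real (B $ i $ j) * v $ j)"
      using v(2) by (auto simp: vec_eq_iff matrix_vector_mult_def map_matrix_def)
    then have "cmod \<mu> * cmod (v $ i) = cmod (\<Sum>j\<in>UNIV. complex_of_real (B $ i $ j) * v $ j)"
      by (metis norm_mult)
    also have "\<dots> \<le> (\<Sum>j\<in>UNIV. \<bar>B $ i $ j\<bar> * cmod (v $ j))"
      by (rule order_trans[OF norm_sum]) (simp add: norm_mult)
    also have "\<dots> \<le> (\<Sum>j\<in>UNIV. \<bar>B $ i $ j\<bar> * S)"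
      by (intro sum_mono mult_left_mono le_S) auto
    finally show ?thesis by (simp add: sum_distrib_right)
  qed
  then have "cmod \<mu> * S \<le> (\<Sum>i\<in>UNIV. (\<Sum>j\<in>UNIV. \<bar>B $ i $ j\<bar>) * S)"
    unfolding S_def sum_distrib_left by (intro sum_mono) (simp add: S_def sum_distrib_left)
  then have "cmod \<mu> * S \<le> (\<Sum>i\<in>UNIV. \<Sum>j\<in>UNIV. \<bar>B $ i $ j\<bar>) * S"
    by (simp add: sum_distrib_right)
  with \<open>0 < S\<close> show "cmod \<mu> \<le> (\<Sum>i\<in>UNIV. \<Sum>j\<in>UNIV. \<bar>B $ i $ j\<bar>)" by simp
qed

text \<open>A Collatz-Wielandt bound: the real eigenpair obtained from Brouwer becomes a complex
  one, and \<open>t \<le> r \<le> \<bar>r\<bar>\<close>. Boundedness of the moduli lets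
  \<open>Sup\<close> dominate \<open>\<bar>r\<bar>\<close>.\<close>

lemma matrix_spectral_radius_ge:
  fixes B :: "real ^ 'n ^ 'n" and w :: "real ^ 'n"
  assumes "0 \<le> B" "0 \<le> w" "w \<noteq> 0" "t *\<^sub>R w \<le> B *v w"
  shows "t \<le> matrix_spectral_radius B"
proof -
  obtain r u where u: "t \<le> r" "u \<noteq> 0" "B *v u = r *\<^sub>R u"
    using nonneg_matrix_eigenvector_ge[OF assms] .
  define v :: "complex ^ 'n" where "v = (\<chi> i. complex_of_real (u $ i))"
  have "map_matrix complex_of_real B *v v = complex_of_real r *s v"
    using u(3) by (auto simp: v_def vec_eq_iff matrix_vector_mult_def map_matrix_def
        simp flip: of_real_mult of_real_sum)
  moreover have "v \<noteq> 0" using u(2) by (auto simp: v_def vec_eq_iff)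
  ultimately have "matrix_eigenvalue B (complex_of_real r)"
    unfolding matrix_eigenvalue_def by blast
  then have "cmod (complex_of_real r) \<le> matrix_spectral_radius B"
    unfolding matrix_spectral_radius_def
    by (intro cSup_upper bdd_above_cmod_matrix_eigenvalues) blast
  with u(1) show ?thesis by simp
qed

lemma nonsingular_M_matrix_inverse_nonneg:
  fixes P :: "real ^ 'n ^ 'n" and z :: "real ^ 'n"
  assumes "nonsingular_M_matrix P" and Pz: "0 \<le> P *v z"
  shows "0 \<le> z"
proof -
  obtain s B where P: "P = mat s - B" and B: "0 \<le> B" and s: "matrix_spectral_radius B < s"
    using assms(1) by (auto simp: nonsingular_M_matrix_def)
  \<comment> \<open>The all-ones vector is subinvariant for \<open>t = 0\<close>.\<close>
  have "0 \<le> matrix_spectral_radius B"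
    using matrix_vector_mult_mono[OF B, of 0 1] B
    by (intro matrix_spectral_radius_ge[of _ 1]) (auto simp: less_eq_vec_def)
  with s have "0 < s" by simp
  have Bz: "B *v z \<le> s *\<^sub>R z"
    using Pz by (simp add: P matrix_vector_mult_diff_rdistrib mat_vector_mult_eq_scaleR less_eq_vec_def)
  define w where "w = (\<chi> i. max 0 (- (z $ i)))"
  have w: "0 \<le> w" "- w \<le> z" by (auto simp: w_def less_eq_vec_def)
  have Bw: "0 \<le> B *v w" using matrix_vector_mult_mono[OF B w(1)] by simp
  have "B *v (- w) \<le> s *\<^sub>R z" using matrix_vector_mult_mono[OF B w(2)] Bz by (rule order_trans)
  moreover have "B *v (- w) = - (B *v w)"
    by (simp add: vec_eq_iff matrix_vector_mult_def sum_negf)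
  ultimately have "s *\<^sub>R (- z) \<le> B *v w" by (auto simp: less_eq_vec_def minus_le_iff)
  \<comment> \<open>Coordinatewise: where \<open>w\<close> vanishes use \<open>Bw\<close>, elsewhere
    \<open>w\<close> agrees with \<open>- z\<close>.\<close>
  with Bw \<open>0 < s\<close> have "s *\<^sub>R w \<le> B *v w" by (auto simp: w_def less_eq_vec_def max_def)
  with s have "w = 0" using matrix_spectral_radius_ge[OF B w(1)] by force
  with w(2) show ?thesis by simp
qed

lemma nonsingular_M_matrix_le_cancel:
  fixes P :: "real ^ 'n ^ 'n" and u v :: "real ^ 'n"
  assumes "nonsingular_M_matrix P" "P *v u \<le> P *v v"
  shows "u \<le> v"
  using nonsingular_M_matrix_inverse_nonneg[OF assms(1), of "v - u"] assms(2)
  by (simp add: matrix_vector_mult_diff_distrib less_eq_vec_def)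

section \<open>Monotonicity of entrywise powers and of nonnegative tensors\<close>

lemma vec_power_mono: "0 \<le> u \<Longrightarrow> u \<le> v \<Longrightarrow> vec_power u r \<le> vec_power v r"
  by (auto simp: vec_power_def less_eq_vec_def intro: power_mono)

lemma vec_power_le_cancel:
  "0 \<le> v \<Longrightarrow> 0 < r \<Longrightarrow> vec_power u r \<le> vec_power v r \<Longrightarrow> u \<le> v"
  by (cases r) (auto simp: vec_power_def less_eq_vec_def simp del: power_Suc intro: power_le_imp_le_base)

lemma tensor_app_mono:
  assumes "tensor_nonneg m \<N>" "0 < m" "0 \<le> u" "u \<le> v"
  shows "tensor_app m \<N> u \<le> tensor_app m \<N> v"
proof -
  \<comment> \<open>Nonnegativity is carried through the induction because multiplying the
    inequalities requires it.\<close>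
  have "0 \<le> (\<Prod>j\<leftarrow>js. u $ j) \<and> (\<Prod>j\<leftarrow>js. u $ j) \<le> (\<Prod>j\<leftarrow>js. v $ j)" for js
    using assms(3,4) by (induction js) (auto simp: less_eq_vec_def intro!: mult_mono intro: order_trans)
  then show ?thesis
    using assms(1,2)
    by (auto simp: tensor_app_def less_eq_vec_def tensor_nonneg_def intro!: sum_mono mult_left_mono)
qed

section \<open>The level-1 splitting\<close>

lemma level1_splitting_nonneg:
  assumes "nonsingular_M_tensor m \<A>" "level1_splitting m \<A> \<M> \<N>" "0 < m"
  shows "tensor_nonneg m \<N>"
  unfolding tensor_nonneg_def
proof (intro allI impI)
  fix "is" :: "'a list" assume len: "length is = m"
  obtain s \<B> where \<A>: "\<A> is = s * identity_tensor m is - \<B> is" and \<B>: "0 \<le> \<B> is"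
    using assms(1) len unfolding nonsingular_M_tensor_def tensor_nonneg_def by blast
  have \<M>: "\<M> is = (if \<exists>i j. is = i # replicate (m - 1) j then \<A> is else 0)"
    and \<N>: "\<A> is = \<M> is - \<N> is"
    using assms(2) len unfolding level1_splitting_def by blast+
  show "0 \<le> \<N> is"
  proof (cases "\<exists>i j. is = i # replicate (m - 1) j")
    case True
    then show ?thesis using \<M> \<N> by simp
  next
    case False
    \<comment> \<open>A constant list would have the shape ruled out by \<open>False\<close>. So the
      identity tensor vanishes at \<open>is\<close>, and \<open>\<N> is\<close> equals
      \<open>\<B> is\<close>.\<close>
    have "is \<noteq> replicate m i" for i
      using False \<open>0 < m\<close> by (cases m) auto
    then show ?thesis using False \<M> \<N> \<A> \<B> by (simp add: identity_tensor_def)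
  qed
qed

text \<open>\<open>\<M>\<close> is supported on indices with constant tail, so its sum over tails
  collapses to a sum over one index \<open>j\<close>, which is a matrix-vector product.\<close>

lemma tensor_app_level1_splitting:
  fixes \<A> :: "'n::finite tensor"
  assumes "2 \<le> m" and split: "level1_splitting m \<A> \<M> \<N>"
  shows "tensor_app m \<A> x = majorization_matrix m \<A> *v vec_power x (m - 1) - tensor_app m \<N> x"
proof -
  define L :: "'n list set" where "L = {js. length js = m - 1}"
  have finL: "finite L" using finite_lists_length_eq[of "UNIV :: 'n set" "m - 1"] by (simp add: L_def)
  have \<M>: "\<M> is = (if \<exists>i j. is = i # replicate (m - 1) j then \<A> is else 0)"
    and \<N>: "\<A> is = \<M> is - \<N> is" if "length is = m" for "is"
    using split that unfolding level1_splitting_def by blast+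
  have "(\<Sum>js\<in>L. \<M> (i # js) * (\<Prod>j\<leftarrow>js. x $ j))
      = (\<Sum>j\<in>UNIV. \<A> (i # replicate (m - 1) j) * (x $ j) ^ (m - 1))" for i
  proof -
    \<comment> \<open>Here \<open>m - 1\<close> is positive; for length 0 all these lists would
      coincide.\<close>
    have inj: "inj (\<lambda>j::'n. replicate (m - 1) j)"
      using \<open>2 \<le> m\<close> by (auto simp: inj_def replicate_eq_replicate)
    have "(\<Sum>js\<in>L. \<M> (i # js) * (\<Prod>j\<leftarrow>js. x $ j))
        = (\<Sum>js\<in>range (\<lambda>j. replicate (m - 1) j). \<M> (i # js) * (\<Prod>j\<leftarrow>js. x $ j))"
      using \<open>2 \<le> m\<close> by (intro sum.mono_neutral_right finL) (auto simp: L_def \<M>)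
    also have "\<dots> = (\<Sum>j\<in>UNIV. \<A> (i # replicate (m - 1) j) * (x $ j) ^ (m - 1))"
      using \<open>2 \<le> m\<close> by (subst sum.reindex[OF inj]) (auto simp: \<M> prod_list_replicate)
    finally show ?thesis .
  qed
  moreover have "(\<Sum>js\<in>L. \<A> (i # js) * (\<Prod>j\<leftarrow>js. x $ j))
      = (\<Sum>js\<in>L. \<M> (i # js) * (\<Prod>j\<leftarrow>js. x $ j)) - (\<Sum>js\<in>L. \<N> (i # js) * (\<Prod>j\<leftarrow>js. x $ j))" for i
    unfolding sum_subtractf[symmetric] left_diff_distrib[symmetric]
    using \<open>2 \<le> m\<close> by (intro sum.cong refl) (simp add: \<N> L_def)
  ultimately show ?thesis
    by (simp add: L_def tensor_app_def majorization_matrix_def vec_power_def matrix_vector_mult_def vec_eq_iff)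
qed

section \<open>Monotone iteration and comparison of the two sequences\<close>

lemma splitting_iteration_decreasing:
  fixes \<A> \<N> :: "'n::finite tensor"
  assumes app: "\<And>v. tensor_app m \<A> v = (P - Q) *v vec_power v (m - 1) - tensor_app m \<N> v"
    and "2 \<le> m" "tensor_nonneg m \<N>" "nonsingular_M_matrix P" "0 \<le> Q"
    and x: "\<And>k. 0 \<le> x k"
    and step: "\<And>k. P *v vec_power (x (Suc k)) (m - 1)
              = Q *v vec_power (x k) (m - 1) + tensor_app m \<N> (x k) + b"
    and start: "b \<le> tensor_app m \<A> (x 0)"
  shows "x (Suc k) \<le> x k"
proof -
  have dec: "x (Suc k) \<le> x k" if "b \<le> tensor_app m \<A> (x k)" for k
  proof -
    have "P *v vec_power (x (Suc k)) (m - 1) \<le> P *v vec_power (x k) (m - 1)"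
      using that unfolding step app matrix_vector_mult_diff_rdistrib
      by (auto simp: less_eq_vec_def algebra_simps)
    then have "vec_power (x (Suc k)) (m - 1) \<le> vec_power (x k) (m - 1)"
      by (rule nonsingular_M_matrix_le_cancel[OF \<open>nonsingular_M_matrix P\<close>])
    then show ?thesis using \<open>2 \<le> m\<close> x by (auto intro: vec_power_le_cancel[of _ "m - 1"])
  qed
  have "b \<le> tensor_app m \<A> (x k)"
  proof (induction k)
    case 0
    show ?case by (rule start)
  next
    case (Suc k)
    note le = dec[OF Suc.IH]
    have "Q *v vec_power (x (Suc k)) (m - 1) \<le> Q *v vec_power (x k) (m - 1)"
      using le x \<open>0 \<le> Q\<close> by (intro matrix_vector_mult_mono vec_power_mono)
    moreover have "tensor_app m \<N> (x (Suc k)) \<le> tensor_app m \<N> (x k)"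
      using le x assms(2,3) by (intro tensor_app_mono) auto
    \<comment> \<open>With \<open>y k = vec_power (x k) (m - 1)\<close>, substituting the step for
      \<open>P *v y (Suc k)\<close> writes the new residual
      \<open>tensor_app m \<A> (x (Suc k)) - b\<close> as \<open>Q *v (y k - y (Suc k))\<close> plus
      the decrease of the \<open>\<N>\<close> term.\<close>
    ultimately show ?case
      unfolding app matrix_vector_mult_diff_rdistrib step
      by (simp add: less_eq_vec_def) (smt (verit))
  qed
  then show ?thesis by (rule dec)
qed

theorem theorem13:
  fixes m :: nat
    and \<A> \<M> \<N> :: "'n::finite tensor"
    and b :: "real ^ 'n"
    and P Q P' Q' :: "real ^ 'n ^ 'n"
    and x x' :: "nat \<Rightarrow> real ^ 'n"
  assumes "m \<ge> 2"
    and "nonsingular_M_tensor m \<A>"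
    and "S_l m \<A> b \<noteq> {}"
    and "level1_splitting m \<A> \<M> \<N>"
    and "majorization_matrix m \<A> = P - Q" and "nonsingular_M_matrix P" and "0 \<le> Q"
    and "majorization_matrix m \<A> = P' - Q'" and "nonsingular_M_matrix P'" and "0 \<le> Q'"
    and "\<And>k. 0 \<le> x k"
    and "\<And>k. P *v vec_power (x (Suc k)) (m - 1)
              = Q *v vec_power (x k) (m - 1) + tensor_app m \<N> (x k) + b"
    and "\<And>k. 0 \<le> x' k"
    and "\<And>k. P' *v vec_power (x' (Suc k)) (m - 1)
              = Q' *v vec_power (x' k) (m - 1) + tensor_app m \<N> (x' k) + b"
    and "x' 0 \<le> x 0" and "\<And>i. 0 < x' 0 $ i"
    and "\<And>i. 0 < tensor_app m \<A> (x 0) $ i" and "b \<le> tensor_app m \<A> (x 0)"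
    and "\<And>i. 0 < tensor_app m \<A> (x' 0) $ i" and "b \<le> tensor_app m \<A> (x' 0)"
    and "Q' \<le> Q"
  shows "\<forall>k. x' k \<le> x k"
proof -
  let ?p = "\<lambda>v. vec_power v (m - 1)"
  note app = tensor_app_level1_splitting[OF assms(1,4)]
  have \<N>: "tensor_nonneg m \<N>" using assms(1,2,4) by (intro level1_splitting_nonneg) auto
  have dec: "x' (Suc k) \<le> x' k" for k
    using splitting_iteration_decreasing[OF app[unfolded assms(8)] assms(1) \<N> assms(9,10,13,14,20)] .
  \<comment> \<open>Both splittings are of the same matrix, so the primed recursion can be read in
    terms of \<open>P\<close> at the cost of \<open>Q - Q'\<close>.\<close>
  have P: "P = P' + (Q - Q')" using assms(5,8) by (simp add: algebra_simps)
  have QQ': "0 \<le> Q - Q'" using assms(21) by (auto simp: less_eq_vec_def)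
  have "x' k \<le> x k" for k
  proof (induction k)
    case 0
    show ?case by (rule assms(15))
  next
    case (Suc k)
    have "(Q - Q') *v ?p (x' (Suc k)) \<le> (Q - Q') *v ?p (x' k)"
      using dec assms(13) QQ' by (intro matrix_vector_mult_mono vec_power_mono)
    \<comment> \<open>The excess \<open>Q - Q'\<close> acts on the new iterate; bounding it by its
      action on the old one completes \<open>Q'\<close> to \<open>Q\<close>.\<close>
    then have "P *v ?p (x' (Suc k)) \<le> Q *v ?p (x' k) + tensor_app m \<N> (x' k) + b"
      unfolding P matrix_vector_mult_add_rdistrib assms(14) matrix_vector_mult_diff_rdistrib
      by (auto simp: less_eq_vec_def algebra_simps)
    also have "\<dots> \<le> Q *v ?p (x k) + tensor_app m \<N> (x k) + b"
    proof -
      have "Q *v ?p (x' k) \<le> Q *v ?p (x k)"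
        using Suc.IH assms(7,13) by (intro matrix_vector_mult_mono vec_power_mono)
      moreover have "tensor_app m \<N> (x' k) \<le> tensor_app m \<N> (x k)"
        using Suc.IH assms(1,13) \<N> by (intro tensor_app_mono) auto
      ultimately show ?thesis by (auto simp: less_eq_vec_def intro: add_mono)
    qed
    also have "\<dots> = P *v ?p (x (Suc k))" by (rule assms(12)[symmetric])
    finally have "?p (x' (Suc k)) \<le> ?p (x (Suc k))"
      by (rule nonsingular_M_matrix_le_cancel[OF assms(6)])
    then show ?case using assms(1,11) by (auto intro: vec_power_le_cancel[of _ "m - 1"])
  qed
  then show ?thesis by blast
qed

end
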